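(* Let $T\in\mathbf{B}(H)$ be left-invertible and analytic. Assume that $$\{U^*M_{\hat\varphi}U:\hat\varphi\in\mathcal{M}(T)\}=\mathcal{W}(T).$$ Then $T$ is reflexive.
   Context: $\mathbb{N}_0=\{0,1,2,\dots\}$. $H$ is a nonzero complex Hilbert space and $\mathbf{B}(H)$ is the algebra of bounded operators on it. $T\in\mathbf{B}(H)$ is left-invertible if $AT=I$ for some $A\in\mathbf{B}(H)$, and analytic if $\bigcap_{n=0}^\infty T^n(H)=\{0\}$. For left-invertible analytic $T$ put $\mathcal{E}=\ker T^*$, let $P_{\mathcal{E}}$ be the orthogonal projection of $H$ onto $\mathcal{E}$, $L=(T^*T)^{-1}T^*$ (the adjoint of the Cauchy dual $T'=T(T^*T)^{-1}$), $r=1/r(L)$ with $r(L)$ the spectral radius of $L$, and $\mathbb{D}_r=\{z\in\mathbb{C}:|z|<r\}$. For $f\in H$ let $(Uf)(z)=\sum_{n=0}^\infty (P_{\mathcal{E}}L^nf)z^n$, $z\in\mathbb{D}_r$; $U$ is an injective linear map from $H$ into the space of $\mathcal{E}$-valued analytic functions on $\mathbb{D}_r$ (Shimorin's model). $\mathcal{H}:=U(H)$ carries the inner product making $U\colon H\to\mathcal{H}$ unitary. For $\boldsymbol f\in\mathcal{H}$, $\hat{\boldsymbol f}(n)=P_{\mathcal{E}}L^nU^*\boldsymbol f$ ($n\in\mathbb{N}_0$) are its Taylor coefficients. For $\hat\varphi\colon\mathbb{N}_0\to\mathbf{B}(\mathcal{E})$ and $\hat f\colon\mathbb{N}_0\to\mathcal{E}$,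 $(\hat\varphi*\hat f)(n)=\sum_{k=0}^n\hat\varphi(k)\hat f(n-k)$. The multiplication operator $M_{\hat\varphi}$ in $\mathcal{H}$ has domain consisting of those $\boldsymbol f\in\mathcal{H}$ for which there is (a necessarily unique) $\boldsymbol g\in\mathcal{H}$ with $\hat\varphi*\hat{\boldsymbol f}=\hat{\boldsymbol g}$, and $M_{\hat\varphi}\boldsymbol f=\boldsymbol g$. $\hat\varphi$ is a generalized multiplier of $T$ if the domain of $M_{\hat\varphi}$ is all of $\mathcal{H}$ (then $M_{\hat\varphi}\in\mathbf{B}(\mathcal{H})$). $\mathcal{M}(T)$ is the set of generalized multipliers $\hat\varphi$ of $T$ all of whose coefficients $\hat\varphi(n)$ are scalar multiples of $I_{\mathcal{E}}$. $\mathcal{W}(T)$ is the smallest subalgebra of $\mathbf{B}(H)$ containing $T$ and the identity and closed in the weak operator topology. For an algebra $\mathcal{W}\subseteq\mathbf{B}(H)$, $\mathrm{Lat}\,\mathcal{W}$ is the set of closed subspaces invariant under every element of $\mathcal{W}$; for a family $\mathfrak{M}$ of subspaces, $\mathrm{Alg}\,\mathfrak{M}$ is the set of $A\in\mathbf{B}(H)$ leaving every member of $\mathfrak{M}$ invariant. $T$ is reflexive if $\mathrm{Alg}\,\mathrm{Lat}\,\mathcal{W}(T)=\mathcal{W}(T)$. *)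

theory Defs
  imports "HOL-Analysis.Analysis"
begin

subsection \<open>Complex Hilbert spaces\<close>

class complex_vector = real_vector +
  fixes scaleC :: "complex \<Rightarrow> 'a \<Rightarrow> 'a" (infixr "*\<^sub>C" 75)
  assumes scaleC_add_right: "a *\<^sub>C (x + y) = a *\<^sub>C x + a *\<^sub>C y"
    and scaleC_add_left: "(a + b) *\<^sub>C x = a *\<^sub>C x + b *\<^sub>C x"
    and scaleC_scaleC: "a *\<^sub>C b *\<^sub>C x = (a * b) *\<^sub>C x"
    and scaleC_one: "1 *\<^sub>C x = x"
    and scaleR_scaleC: "t *\<^sub>R x = complex_of_real t *\<^sub>C x"

global_interpretation complex_vector:
  vector_space "scaleC :: complex \<Rightarrow> 'a \<Rightarrow> 'a::complex_vector"
  by unfold_locales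
    (simp_all add: scaleC_add_right scaleC_add_left scaleC_scaleC scaleC_one)

text \<open>The inner product is linear in its first argument.\<close>

class complex_inner = complex_vector + real_normed_vector +
  fixes cinner :: "'a \<Rightarrow> 'a \<Rightarrow> complex"
  assumes cinner_commute: "cinner x y = cnj (cinner y x)"
    and cinner_add_left: "cinner (x + y) z = cinner x z + cinner y z"
    and cinner_scaleC_left: "cinner (a *\<^sub>C x) y = a * cinner x y"
    and cinner_ge_zero: "0 \<le> Re (cinner x x)"
    and cinner_eq_zero_iff: "cinner x x = 0 \<longleftrightarrow> x = 0"
    and norm_eq_sqrt_cinner: "norm x = sqrt (Re (cinner x x))"

class chilbert_space = complex_inner + complete_space

instantiation complex :: chilbert_space
begin

definition scaleC_complex :: "complex \<Rightarrow> complex \<Rightarrow> complex"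
  where "scaleC_complex a x = a * x"

definition cinner_complex :: "complex \<Rightarrow> complex \<Rightarrow> complex"
  where "cinner_complex x y = x * cnj y"

instance
proof
  fix a b x y z :: complex and t :: real
  show "a *\<^sub>C (x + y) = a *\<^sub>C x + a *\<^sub>C y" "(a + b) *\<^sub>C x = a *\<^sub>C x + b *\<^sub>C x"
    "a *\<^sub>C b *\<^sub>C x = (a * b) *\<^sub>C x" "1 *\<^sub>C x = x" "t *\<^sub>R x = complex_of_real t *\<^sub>C x"
    by (simp_all add: scaleC_complex_def algebra_simps scaleR_conv_of_real)
  show "cinner x y = cnj (cinner y x)" "cinner (x + y) z = cinner x z + cinner y z"
    "cinner (a *\<^sub>C x) y = a * cinner x y" "0 \<le> Re (cinner x x)"
    "cinner x x = 0 \<longleftrightarrow> x = 0"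
    by (simp_all add: cinner_complex_def scaleC_complex_def algebra_simps)
  show "norm x = sqrt (Re (cinner x x))"
    by (simp add: cinner_complex_def cmod_def power2_eq_square)
qed

end

subsection \<open>Bounded operators\<close>

text \<open>
  Bounded operators on a subspace \<open>S\<close> are functions that are \<open>undefined\<close> outside \<open>S\<close>, so that
  equality of operators on \<open>S\<close> is equality of functions.
\<close>

definition bounded_ops :: "'a::complex_inner set \<Rightarrow> ('a \<Rightarrow> 'a) set"
  where "bounded_ops S = {A \<in> S \<rightarrow>\<^sub>E S.
    (\<forall>x\<in>S. \<forall>y\<in>S. A (x + y) = A x + A y) \<and>
    (\<forall>c. \<forall>x\<in>S. A (c *\<^sub>C x) = c *\<^sub>C A x) \<and>
    (\<exists>K. \<forall>x\<in>S. norm (A x) \<le> K * norm x)}"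

abbreviation BH :: "('a::complex_inner \<Rightarrow> 'a) set"
  where "BH \<equiv> bounded_ops UNIV"

definition adj :: "('a::complex_inner \<Rightarrow> 'a) \<Rightarrow> 'a \<Rightarrow> 'a"
  where "adj A = (THE B. \<forall>x y. cinner (A x) y = cinner x (B y))"

definition orth_proj :: "'a::complex_inner set \<Rightarrow> 'a \<Rightarrow> 'a"
  where "orth_proj S x = (THE p. p \<in> S \<and> (\<forall>y\<in>S. cinner (x - p) y = 0))"

definition spectrum :: "('a::complex_inner \<Rightarrow> 'a) \<Rightarrow> complex set"
  where "spectrum A = {c. \<not> (\<exists>B\<in>BH. (\<forall>x. B (A x - c *\<^sub>C x) = x) \<and> (\<forall>x. A (B x) - c *\<^sub>C B x = x))}"

definition spectral_radius :: "('a::complex_inner \<Rightarrow> 'a) \<Rightarrow> real"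
  where "spectral_radius A = (SUP c\<in>spectrum A. cmod c)"

definition left_invertible :: "('a::complex_inner \<Rightarrow> 'a) \<Rightarrow> bool"
  where "left_invertible T \<longleftrightarrow> (\<exists>A\<in>BH. A \<circ> T = id)"

definition analytic :: "('a::complex_inner \<Rightarrow> 'a) \<Rightarrow> bool"
  where "analytic T \<longleftrightarrow> (\<Inter>n. range (T ^^ n)) = {0}"

subsection \<open>Shimorin's analytic model\<close>

definition coker :: "('a::complex_inner \<Rightarrow> 'a) \<Rightarrow> 'a set"
  where "coker T = {x. adj T x = 0}"

definition cauchy_dual_adj :: "('a::complex_inner \<Rightarrow> 'a) \<Rightarrow> 'a \<Rightarrow> 'a"
  where "cauchy_dual_adj T = inv (adj T \<circ> T) \<circ> adj T"

definition model_radius :: "('a::complex_inner \<Rightarrow> 'a) \<Rightarrow> real"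
  where "model_radius T = 1 / spectral_radius (cauchy_dual_adj T)"

text \<open>Functions on the disc are represented as functions on the plane vanishing off the disc.\<close>

definition model_U :: "('a::complex_inner \<Rightarrow> 'a) \<Rightarrow> 'a \<Rightarrow> complex \<Rightarrow> 'a"
  where "model_U T f = (\<lambda>z. if z \<in> ball 0 (model_radius T)
    then \<Sum>n. z ^ n *\<^sub>C orth_proj (coker T) ((cauchy_dual_adj T ^^ n) f) else 0)"

definition model_space :: "('a::complex_inner \<Rightarrow> 'a) \<Rightarrow> (complex \<Rightarrow> 'a) set"
  where "model_space T = range (model_U T)"

text \<open>The inner product on the model space is transported along the injective map \<open>model_U T\<close>.\<close>

definition model_cinner ::
    "('a::complex_inner \<Rightarrow> 'a) \<Rightarrow> (complex \<Rightarrow> 'a) \<Rightarrow> (complex \<Rightarrow> 'a) \<Rightarrow> complex"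
  where "model_cinner T f g = cinner (inv (model_U T) f) (inv (model_U T) g)"

text \<open>The Hilbert space adjoint of \<open>model_U T\<close>, relevant on the model space only.\<close>

definition model_U_adj :: "('a::complex_inner \<Rightarrow> 'a) \<Rightarrow> (complex \<Rightarrow> 'a) \<Rightarrow> 'a"
  where "model_U_adj T f = (THE h. \<forall>x. model_cinner T (model_U T x) f = cinner x h)"

definition taylor_coeff :: "('a::complex_inner \<Rightarrow> 'a) \<Rightarrow> (complex \<Rightarrow> 'a) \<Rightarrow> nat \<Rightarrow> 'a"
  where "taylor_coeff T f n =
    orth_proj (coker T) ((cauchy_dual_adj T ^^ n) (model_U_adj T f))"

subsection \<open>Generalized multipliers\<close>

definition conv :: "(nat \<Rightarrow> 'a \<Rightarrow> 'a) \<Rightarrow> (nat \<Rightarrow> 'a) \<Rightarrow> nat \<Rightarrow> 'a::complex_inner"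
  where "conv \<phi> f n = (\<Sum>k\<le>n. \<phi> k (f (n - k)))"

definition mult_dom ::
    "('a::complex_inner \<Rightarrow> 'a) \<Rightarrow> (nat \<Rightarrow> 'a \<Rightarrow> 'a) \<Rightarrow> (complex \<Rightarrow> 'a) set"
  where "mult_dom T \<phi> =
    {f \<in> model_space T. \<exists>g\<in>model_space T. conv \<phi> (taylor_coeff T f) = taylor_coeff T g}"

definition mult_op ::
    "('a::complex_inner \<Rightarrow> 'a) \<Rightarrow> (nat \<Rightarrow> 'a \<Rightarrow> 'a) \<Rightarrow> (complex \<Rightarrow> 'a) \<Rightarrow> complex \<Rightarrow> 'a"
  where "mult_op T \<phi> f =
    (THE g. g \<in> model_space T \<and> conv \<phi> (taylor_coeff T f) = taylor_coeff T g)"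

definition gen_multiplier :: "('a::complex_inner \<Rightarrow> 'a) \<Rightarrow> (nat \<Rightarrow> 'a \<Rightarrow> 'a) \<Rightarrow> bool"
  where "gen_multiplier T \<phi> \<longleftrightarrow>
    (\<forall>n. \<phi> n \<in> bounded_ops (coker T)) \<and> mult_dom T \<phi> = model_space T"

definition scalar_multipliers :: "('a::complex_inner \<Rightarrow> 'a) \<Rightarrow> (nat \<Rightarrow> 'a \<Rightarrow> 'a) set"
  where "scalar_multipliers T =
    {\<phi>. gen_multiplier T \<phi> \<and> (\<forall>n. \<exists>c. \<phi> n = (\<lambda>x\<in>coker T. c *\<^sub>C x))}"

subsection \<open>Operator algebras and reflexivity\<close>

definition weak_operator_topology :: "('a::complex_inner \<Rightarrow> 'a) topology"
  where "weak_operator_topology =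
    topology_generated_by {{A \<in> BH. cinner (A x) y \<in> V} | x y V. open V}"

definition subalgebra :: "('a::complex_inner \<Rightarrow> 'a) set \<Rightarrow> bool"
  where "subalgebra W \<longleftrightarrow> W \<subseteq> BH \<and> (\<lambda>x. 0) \<in> W \<and>
    (\<forall>A\<in>W. \<forall>B\<in>W. (\<lambda>x. A x + B x) \<in> W \<and> A \<circ> B \<in> W) \<and>
    (\<forall>c. \<forall>A\<in>W. (\<lambda>x. c *\<^sub>C A x) \<in> W)"

definition wot_algebra :: "('a::complex_inner \<Rightarrow> 'a) \<Rightarrow> ('a \<Rightarrow> 'a) set"
  where "wot_algebra T =
    \<Inter> {W. subalgebra W \<and> T \<in> W \<and> id \<in> W \<and> closedin weak_operator_topology W}"

definition Lat :: "('a::complex_inner \<Rightarrow> 'a) set \<Rightarrow> 'a set set"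
  where "Lat W = {S. complex_vector.subspace S \<and> closed S \<and> (\<forall>A\<in>W. A ` S \<subseteq> S)}"

definition Alg :: "'a::complex_inner set set \<Rightarrow> ('a \<Rightarrow> 'a) set"
  where "Alg M = {A \<in> BH. \<forall>S\<in>M. A ` S \<subseteq> S}"

definition reflexive :: "('a::complex_inner \<Rightarrow> 'a) \<Rightarrow> bool"
  where "reflexive T \<longleftrightarrow> Alg (Lat (wot_algebra T)) = wot_algebra T"

end

theory Submission
  imports Defs
begin

text \<open>
  Every \<open>f\<close> is determined by its coefficients \<open>P L\<^sup>n f\<close>. For \<open>e\<close> in the kernel of the adjoint of
  \<open>T\<close> and small \<open>z\<close>, the kernel of the bounded functional \<open>f \<mapsto> \<langle>(U f)(z), e\<rangle>\<close> is invariant under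
  every operator that acts on coefficients as convolution with a scalar sequence, hence by
  hypothesis it lies in \<open>Lat W(T)\<close>. An operator \<open>A\<close> in \<open>Alg Lat W(T)\<close> preserves all these kernels,
  so \<open>\<langle>(U A f)(z), e\<rangle>\<close> is a multiple of \<open>\<langle>(U f)(z), e\<rangle>\<close> by a factor independent of \<open>f\<close>. Comparing
  power series coefficients, each \<open>P L\<^sup>n A\<close> preserves orthogonality on the kernel of the adjoint and
  is therefore scalar there, and \<open>A\<close> itself is convolution with a scalar sequence.
\<close>

subsection \<open>Projections and adjoints in complex Hilbert spaces\<close>

instance chilbert_space \<subseteq> banach ..

lemma cinner_add_right: "cinner x (y + z) = cinner x y + cinner (x::'a::complex_inner) z"
  by (metis cinner_commute cinner_add_left complex_cnj_add)

lemma cinner_scaleC_right: "cinner x (a *\<^sub>C y) = cnj a * cinner (x::'a::complex_inner) y"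
  by (metis cinner_commute cinner_scaleC_left complex_cnj_mult)

lemma uminus_eq_scaleC: "- x = (- 1) *\<^sub>C (x::'a::complex_vector)"
  by (simp add: complex_vector.scale_minus_left)

lemma cinner_minus_left: "cinner (- x) y = - cinner (x::'a::complex_inner) y"
  by (subst uminus_eq_scaleC) (simp only: cinner_scaleC_left mult_minus1)

lemma cinner_minus_right: "cinner x (- y) = - cinner (x::'a::complex_inner) y"
  by (metis cinner_commute cinner_minus_left complex_cnj_minus)

lemma cinner_diff_left: "cinner (x - y) z = cinner x z - cinner (y::'a::complex_inner) z"
  by (simp only: diff_conv_add_uminus cinner_add_left cinner_minus_left)

lemma cinner_diff_right: "cinner x (y - z) = cinner x y - cinner (x::'a::complex_inner) z"
  by (simp only: diff_conv_add_uminus cinner_add_right cinner_minus_right)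

lemma cinner_zero_left [simp]: "cinner 0 (x::'a::complex_inner) = 0"
  using cinner_diff_left[of 0 0 x] by simp

lemma cinner_zero_right [simp]: "cinner (x::'a::complex_inner) 0 = 0"
  using cinner_diff_right[of x 0 0] by simp

lemma cinner_sum_left: "cinner (sum f S) y = (\<Sum>i\<in>S. cinner (f i) (y::'a::complex_inner))"
  by (induction S rule: infinite_finite_induct) (simp_all add: cinner_add_left)

lemmas cinner_simps = cinner_add_left cinner_add_right cinner_scaleC_left cinner_scaleC_right
  cinner_diff_left cinner_diff_right cinner_minus_left cinner_minus_right

lemma cinner_self: "cinner x x = complex_of_real ((norm (x::'a::complex_inner))\<^sup>2)"
proof -
  have "Im (cinner x x) = 0"
    using arg_cong[OF cinner_commute[of x x], of Im] by simp
  then show ?thesis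
    by (simp add: norm_eq_sqrt_cinner cinner_ge_zero complex_eq_iff)
qed

lemma norm_sq_add:
  "(norm (x + y))\<^sup>2 = (norm x)\<^sup>2 + 2 * Re (cinner x y) + (norm (y::'a::complex_inner))\<^sup>2"
proof -
  have "Re (cinner y x) = Re (cinner x y)"
    by (subst cinner_commute) simp
  then have "Re (cinner (x + y) (x + y)) = Re (cinner x x) + 2 * Re (cinner x y) + Re (cinner y y)"
    by (simp add: cinner_simps)
  then show ?thesis
    by (simp add: cinner_self)
qed

lemma norm_sq_diff:
  "(norm (x - y))\<^sup>2 = (norm x)\<^sup>2 - 2 * Re (cinner x y) + (norm (y::'a::complex_inner))\<^sup>2"
  using norm_sq_add[of x "- y"] by (simp add: cinner_simps)

lemma norm_scaleC: "norm (c *\<^sub>C x) = cmod c * norm (x::'a::complex_inner)"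
proof -
  have "cinner (c *\<^sub>C x) (c *\<^sub>C x) = (c * cnj c) * cinner x x"
    by (simp add: cinner_simps)
  then have "complex_of_real ((norm (c *\<^sub>C x))\<^sup>2) = complex_of_real ((cmod c * norm x)\<^sup>2)"
    unfolding cinner_self by (simp add: complex_norm_square[symmetric] power_mult_distrib)
  then have "(norm (c *\<^sub>C x))\<^sup>2 = (cmod c * norm x)\<^sup>2"
    by (simp only: of_real_eq_iff)
  then show ?thesis
    by simp
qed

text \<open>Removing the component of \<open>x\<close> along \<open>y\<close> is the Gram-Schmidt
  step behind Cauchy-Schwarz, the projection theorem and the analysis of operators that preserve
  orthogonality.\<close>

lemma orthogonal_residual:
  fixes x y :: "'a::complex_inner"
  shows "cinner (x - (cinner x y / cinner y y) *\<^sub>C y) y = 0"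
  by (cases "y = 0") (simp_all add: cinner_simps cinner_eq_zero_iff)

text \<open>By Pythagoras the component of \<open>x\<close> along \<open>y\<close>, whose norm is
  \<open>cmod (cinner x y) / norm y\<close>, is no longer than \<open>x\<close>.\<close>

lemma Cauchy_Schwarz_cinner: "cmod (cinner x y) \<le> norm x * norm (y::'a::complex_inner)"
proof (cases "y = 0")
  case False
  define c where "c = cinner x y / cinner y y"
  have "(norm ((x - c *\<^sub>C y) + c *\<^sub>C y))\<^sup>2 = (norm (x - c *\<^sub>C y))\<^sup>2 + (norm (c *\<^sub>C y))\<^sup>2"
    unfolding norm_sq_add cinner_scaleC_right c_def orthogonal_residual by simp
  then have "(norm (c *\<^sub>C y))\<^sup>2 \<le> (norm x)\<^sup>2"
    by simp
  then have "norm (c *\<^sub>C y) \<le> norm x"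
    using power2_le_imp_le by auto
  moreover have "norm (c *\<^sub>C y) = cmod (cinner x y) / norm y"
    using False by (simp add: norm_scaleC c_def cinner_self norm_divide norm_mult power2_eq_square)
  ultimately show ?thesis
    using False by (simp add: field_simps)
qed simp

lemma eq_if_cinner_eq: "(\<And>z. cinner x z = cinner y z) \<Longrightarrow> x = (y::'a::complex_inner)"
  by (metis cinner_diff_left cinner_eq_zero_iff right_minus_eq)

section \<open>Orthogonal projection onto closed subspaces and Riesz representation\<close>

lemma subspace_halfway:
  assumes "complex_vector.subspace S" "s \<in> S" "t \<in> S"
  shows "(1/2) *\<^sub>R (s + t) \<in> (S :: 'a::complex_inner set)"
  using assms by (simp add: scaleR_scaleC complex_vector.subspace_add complex_vector.subspace_scale)

text \<open>A minimizing sequence is Cauchy by the parallelogram law, because midpoints stay in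
  \<open>S\<close> and cannot beat the infimum \<open>D\<close>. Completeness gives a limit and
  closedness keeps it in \<open>S\<close>.\<close>

lemma exists_closest_point:
  fixes S :: "'a::chilbert_space set"
  assumes S: "complex_vector.subspace S" and "closed S"
  obtains p where "p \<in> S" "\<And>s. s \<in> S \<Longrightarrow> norm (y - p) \<le> norm (y - s)"
proof -
  define D where "D = (INF s\<in>S. (norm (y - s))\<^sup>2)"
  have ne: "S \<noteq> {}"
    using complex_vector.subspace_0[OF S] by auto
  have bdd: "bdd_below ((\<lambda>s. (norm (y - s))\<^sup>2) ` S)"
    by (rule bdd_belowI[of _ 0]) auto
  have D_le: "D \<le> (norm (y - s))\<^sup>2" if "s \<in> S" for s
    unfolding D_def by (rule cINF_lower[OF bdd that])
  have "\<exists>s\<in>S. (norm (y - s))\<^sup>2 < D + 1 / Suc n" for n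
    using cINF_less_iff[OF ne bdd, of "D + 1 / Suc n"] by (simp add: D_def)
  then obtain s where s: "\<And>n. s n \<in> S" "\<And>n. (norm (y - s n))\<^sup>2 < D + 1 / Suc n"
    by metis
  \<comment> \<open>The midpoint accounts for at least \<open>4 * D\<close>, which cancels against
    the two terms \<open>2 * D\<close> and leaves only the slack of the sequence.\<close>
  have par: "(norm (s m - s n))\<^sup>2 \<le> 2 / Suc m + 2 / Suc n" for m n
  proof -
    define a b where "a = y - s m" and "b = y - s n"
    have "(norm (a - b))\<^sup>2 + (norm (a + b))\<^sup>2 = 2 * (norm a)\<^sup>2 + 2 * (norm b)\<^sup>2"
      by (simp add: norm_sq_add norm_sq_diff)
    moreover have "a + b = 2 *\<^sub>R (y - (1/2) *\<^sub>R (s m + s n))"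
      by (simp add: a_def b_def algebra_simps scaleR_2)
    then have "(norm (a + b))\<^sup>2 = 4 * (norm (y - (1/2) *\<^sub>R (s m + s n)))\<^sup>2"
      by (simp add: power_mult_distrib del: scaleR_add_right)
    moreover have "D \<le> (norm (y - (1/2) *\<^sub>R (s m + s n)))\<^sup>2"
      by (intro D_le subspace_halfway S s)
    moreover have "norm (a - b) = norm (s m - s n)"
      by (simp add: a_def b_def norm_minus_commute)
    ultimately show ?thesis
      using s(2)[of m] s(2)[of n] by (simp add: a_def b_def)
  qed
  have "Cauchy s"
  proof (rule CauchyI)
    fix e :: real
    assume "0 < e"
    then obtain M :: nat where M: "4 / e\<^sup>2 < M"
      using reals_Archimedean2 by blast
    have M0: "0 < real M"
      using M \<open>0 < e\<close> by (smt (verit) divide_pos_pos zero_less_power)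
    have "norm (s m - s n) < e" if "m \<ge> M" "n \<ge> M" for m n
    proof -
      have "2 / real (Suc m) \<le> 2 / M" "2 / real (Suc n) \<le> 2 / M"
        using that M0 by (auto intro!: divide_left_mono)
      then have "(norm (s m - s n))\<^sup>2 \<le> 4 / M"
        using par[of m n] by linarith
      also have "\<dots> < e\<^sup>2"
        using M M0 \<open>0 < e\<close> by (simp add: field_simps)
      finally show ?thesis
        using \<open>0 < e\<close> power2_less_imp_less by force
    qed
    then show "\<exists>M. \<forall>m\<ge>M. \<forall>n\<ge>M. norm (s m - s n) < e"
      by blast
  qed
  then obtain p where p: "s \<longlonglongrightarrow> p"
    using Cauchy_convergent convergent_def by blast
  have "(\<lambda>n. (norm (y - s n))\<^sup>2) \<longlonglongrightarrow> (norm (y - p))\<^sup>2"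
    by (intro tendsto_intros p)
  moreover have "(\<lambda>n. D + 1 / real (Suc n)) \<longlonglongrightarrow> D + 0"
    using LIMSEQ_inverse_real_of_nat by (intro tendsto_intros) (simp add: inverse_eq_divide)
  ultimately have "(norm (y - p))\<^sup>2 \<le> D + 0"
    by (rule LIMSEQ_le) (use s(2) less_imp_le in blast)
  then have "norm (y - p) \<le> norm (y - t)" if "t \<in> S" for t
    using D_le[OF that] by (auto intro: power2_le_imp_le[OF order_trans])
  moreover have "p \<in> S"
    using closed_sequentially[OF \<open>closed S\<close> s(1) p] .
  ultimately show ?thesis
    using that by blast
qed

text \<open>The closest point works: if \<open>y - p\<close> were not orthogonal to
  \<open>s\<close>, moving \<open>p\<close> by \<open>c *\<^sub>C s\<close> would strictly decrease
  the distance.\<close>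

lemma exists_orthogonal_projection:
  fixes S :: "'a::chilbert_space set"
  assumes S: "complex_vector.subspace S" and "closed S"
  obtains p where "p \<in> S" "\<And>s. s \<in> S \<Longrightarrow> cinner (y - p) s = 0"
proof -
  obtain p where p: "p \<in> S" "\<And>s. s \<in> S \<Longrightarrow> norm (y - p) \<le> norm (y - s)"
    using exists_closest_point[OF assms] by metis
  have "cinner (y - p) s = 0" if "s \<in> S" for s
  proof (rule ccontr)
    assume nz: "cinner (y - p) s \<noteq> 0"
    define c where "c = cinner (y - p) s / cinner s s"
    define z where "z = y - p - c *\<^sub>C s"
    have "(norm (z + c *\<^sub>C s))\<^sup>2 = (norm z)\<^sup>2 + (norm (c *\<^sub>C s))\<^sup>2"
      unfolding norm_sq_add cinner_scaleC_right z_def c_def orthogonal_residual by simp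
    moreover have "norm (y - p) \<le> norm z"
      using p(2)[of "p + c *\<^sub>C s"] p(1) that S
      by (simp add: z_def diff_diff_eq complex_vector.subspace_add complex_vector.subspace_scale)
    then have "(norm (y - p))\<^sup>2 \<le> (norm z)\<^sup>2"
      by simp
    ultimately have "c *\<^sub>C s = 0"
      by (simp add: z_def)
    then show False
      using nz by (auto simp: c_def cinner_eq_zero_iff)
  qed
  then show ?thesis
    using p(1) that by blast
qed

text \<open>Complex linearity contains real linearity, which opens the library facts on
  \<open>bounded_linear\<close>.\<close>

lemma bounded_linear_if_complex_linear:
  fixes f :: "'a::complex_inner \<Rightarrow> 'b::complex_inner"
  assumes "\<And>x y. f (x + y) = f x + f y" "\<And>c x. f (c *\<^sub>C x) = c *\<^sub>C f x"
    "\<And>x. norm (f x) \<le> K * norm x"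
  shows "bounded_linear f"
  by (rule bounded_linear_intro[where K = K]) (simp_all add: assms scaleR_scaleC mult.commute)

text \<open>A vector \<open>e\<close> orthogonal to the kernel of a nonzero \<open>g\<close>
  represents \<open>g\<close> up to a factor, since \<open>x - (g x / g e) *\<^sub>C e\<close>
  always lies in that kernel.\<close>

lemma riesz_representation:
  fixes g :: "'a::chilbert_space \<Rightarrow> complex"
  assumes add: "\<And>x y. g (x + y) = g x + g y" and scale: "\<And>c x. g (c *\<^sub>C x) = c * g x"
    and bound: "\<And>x. cmod (g x) \<le> K * norm x"
  obtains k where "\<And>x. g x = cinner x k"
proof (cases "\<forall>x. g x = 0")
  case True
  then show ?thesis
    using that[of 0] by simp
next
  case False
  then obtain y where y: "g y \<noteq> 0"
    by blast
  have lin: "bounded_linear g"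
    by (rule bounded_linear_if_complex_linear[where K = K])
      (simp_all add: assms scaleC_complex_def)
  define S where "S = {x. g x = 0}"
  have "complex_vector.subspace S"
    using linear_0[OF bounded_linear.linear[OF lin]]
    by (simp add: S_def complex_vector.subspace_def add scale)
  moreover have "closed S"
    unfolding S_def using lin
    by (intro closed_Collect_eq) (auto intro: linear_continuous_on)
  ultimately obtain p where p: "p \<in> S" "\<And>s. s \<in> S \<Longrightarrow> cinner (y - p) s = 0"
    by (rule exists_orthogonal_projection[of S y]) blast
  define e where "e = y - p"
  have ge: "g e \<noteq> 0"
    using y p(1) bounded_linear.linear[OF lin] by (simp add: e_def S_def linear_diff)
  then have e0: "cinner e e \<noteq> 0"
    using linear_0[OF bounded_linear.linear[OF lin]] by (auto simp: cinner_eq_zero_iff)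
  \<comment> \<open>The conjugate appears because \<open>cinner\<close> is conjugate-linear in its
    second argument.\<close>
  have "g x = cinner x (cnj (g e / cinner e e) *\<^sub>C e)" for x
  proof -
    have "x - (g x / g e) *\<^sub>C e \<in> S"
      using ge bounded_linear.linear[OF lin] by (simp add: S_def linear_diff scale)
    then have "cinner e (x - (g x / g e) *\<^sub>C e) = 0"
      using p(2) by (simp add: e_def)
    then have "cinner (x - (g x / g e) *\<^sub>C e) e = 0"
      by (subst cinner_commute) simp
    then show ?thesis
      using ge e0 by (simp add: cinner_simps field_simps)
  qed
  then show ?thesis
    using that by blast
qed

section \<open>Bounded operators and their adjoints\<close>

lemma BH_iff:
  "A \<in> BH \<longleftrightarrow> (\<forall>x y. A (x + y) = A x + A y) \<and> (\<forall>c x. A (c *\<^sub>C x) = c *\<^sub>C A x) \<and>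
    (\<exists>K. \<forall>x. norm (A x) \<le> K * norm x)"
  by (auto simp: bounded_ops_def)

lemma BH_add: "A \<in> BH \<Longrightarrow> A (x + y) = A x + A y"
  and BH_scaleC: "A \<in> BH \<Longrightarrow> A (c *\<^sub>C x) = c *\<^sub>C A x"
  by (simp_all add: BH_iff)

lemma BH_bounded_linear: "A \<in> BH \<Longrightarrow> bounded_linear A"
  unfolding BH_iff by (blast intro: bounded_linear_if_complex_linear)

lemma BH_diff: "A \<in> BH \<Longrightarrow> A (x - y) = A x - A y"
  and BH_zero: "A \<in> BH \<Longrightarrow> A 0 = 0"
  by (auto dest!: BH_bounded_linear bounded_linear.linear simp: linear_diff linear_0)

text \<open>Strict positivity of the constant allows later divisions by it.\<close>

lemma BH_bound:
  assumes "A \<in> BH"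
  obtains K where "K > 0" "\<And>x. norm (A x) \<le> K * norm x"
proof -
  obtain K where K: "\<And>x. norm (A x) \<le> K * norm x"
    using assms BH_iff by blast
  have "norm (A x) \<le> (\<bar>K\<bar> + 1) * norm x" for x
    by (rule order_trans[OF K]) (intro mult_right_mono, simp_all)
  then show ?thesis
    using that[of "\<bar>K\<bar> + 1"] by simp
qed

text \<open>Riesz representation yields an adjoint and testing against all vectors shows it unique,
  so the description in \<open>adj\<close> denotes it.\<close>

lemma cinner_adj:
  fixes A :: "'a::chilbert_space \<Rightarrow> 'a"
  assumes "A \<in> BH"
  shows "cinner (A x) y = cinner x (adj A y)"
proof -
  obtain K where K: "K > 0" "\<And>x. norm (A x) \<le> K * norm x"
    by (rule BH_bound[OF assms]) blast
  have "\<exists>k. \<forall>x. cinner (A x) y = cinner x k" for y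
  proof -
    have "cmod (cinner (A x) y) \<le> (K * norm y) * norm x" for x
      using Cauchy_Schwarz_cinner[of "A x" y] mult_right_mono[OF K(2)[of x], of "norm y"]
      by (simp add: mult_ac)
    then show ?thesis
      using riesz_representation[of "\<lambda>x. cinner (A x) y"] BH_add[OF assms] BH_scaleC[OF assms]
      by (metis cinner_add_left cinner_scaleC_left)
  qed
  then obtain B where B: "\<forall>x y. cinner (A x) y = cinner x (B y)"
    by metis
  moreover have "B' = B" if "\<forall>x y. cinner (A x) y = cinner x (B' y)" for B'
    using that B by (metis cinner_commute eq_if_cinner_eq ext)
  ultimately have "\<forall>x y. cinner (A x) y = cinner x (adj A y)"
    unfolding adj_def by (rule theI)
  then show ?thesis
    by blast
qed

lemma adj_eqI:
  fixes A :: "'a::chilbert_space \<Rightarrow> 'a"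
  assumes "A \<in> BH" "\<And>x. cinner (A x) y = cinner x z"
  shows "adj A y = z"
  by (metis assms cinner_adj cinner_commute eq_if_cinner_eq)

lemma adj_add: "A \<in> BH \<Longrightarrow> adj A (x + y) = adj A x + adj A (y::'a::chilbert_space)"
  and adj_scaleC: "A \<in> BH \<Longrightarrow> adj A (c *\<^sub>C x) = c *\<^sub>C adj A (x::'a::chilbert_space)"
  by (rule adj_eqI; simp add: cinner_adj cinner_simps)+

subsection \<open>Uniqueness of power series and scalar operators\<close>

text \<open>Once the coefficients below \<open>n\<close> vanish, \<open>z ^ n\<close> cancels for
  \<open>z \<noteq> 0\<close>, and \<open>a n\<close> is the limit at 0 of the remaining
  series.\<close>

lemma powser_eq_zeroD:
  fixes a :: "nat \<Rightarrow> 'a::{real_normed_field,banach}"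
  assumes "s > 0" and sums: "\<And>z. norm z < s \<Longrightarrow> (\<lambda>n. a n * z ^ n) sums 0"
  shows "a n = 0"
proof (induction n rule: less_induct)
  case (less n)
  have "(\<lambda>k. a (k + n) * z ^ k) sums 0" if "z \<noteq> 0" "norm z < s" for z
  proof -
    have "(\<lambda>k. a (k + n) * z ^ (k + n)) sums 0"
      using sums_zero_iff_shift[of n "\<lambda>n. a n * z ^ n" 0] less sums that by simp
    then have "(\<lambda>k. z ^ n * (a (k + n) * z ^ k)) sums (z ^ n * 0)"
      by (simp add: power_add mult_ac)
    then show ?thesis
      using that by (subst (asm) sums_mult_iff) simp_all
  qed
  then have "((\<lambda>z. 0) \<longlongrightarrow> a (0 + n)) (at (0::'a))"
    by (rule powser_limit_0_strong[OF \<open>s > 0\<close>])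
  then show ?case
    using LIM_unique[of "\<lambda>z. 0" "a n" 0 0] by simp
qed

lemma powser_eqD:
  fixes a b :: "nat \<Rightarrow> 'a::{real_normed_field,banach}"
  assumes "s > 0" and "\<And>z. norm z < s \<Longrightarrow> (\<lambda>n. a n * z ^ n) sums f z"
    "\<And>z. norm z < s \<Longrightarrow> (\<lambda>n. b n * z ^ n) sums f z"
  shows "a n = b n"
proof -
  have "(\<lambda>n. (a n - b n) * z ^ n) sums 0" if "norm z < s" for z
    using sums_diff[OF assms(2,3)[OF that]] by (simp add: left_diff_distrib)
  then show ?thesis
    using powser_eq_zeroD[OF \<open>s > 0\<close>, of "\<lambda>n. a n - b n" n] by simp
qed

text \<open>First every vector of \<open>E\<close> is an eigenvector. Then orthogonal nonzero
  vectors share their eigenvalue, and splitting \<open>x\<close> along a fixed \<open>x0\<close>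
  gives one scalar for all of \<open>E\<close>.\<close>

lemma scalar_if_preserves_orthogonality:
  fixes A :: "'a::complex_inner \<Rightarrow> 'a"
  assumes E: "complex_vector.subspace E" and A_E: "\<And>x. x \<in> E \<Longrightarrow> A x \<in> E"
    and add: "\<And>x y. A (x + y) = A x + A y"
    and scale: "\<And>c x. A (c *\<^sub>C x) = c *\<^sub>C A x"
    and orth: "\<And>x y. x \<in> E \<Longrightarrow> y \<in> E \<Longrightarrow> cinner x y = 0 \<Longrightarrow> cinner (A x) y = 0"
  obtains c where "\<And>x. x \<in> E \<Longrightarrow> A x = c *\<^sub>C x"
proof (cases "\<exists>x0\<in>E. x0 \<noteq> 0")
  case True
  then obtain x0 where x0: "x0 \<in> E" "x0 \<noteq> 0"
    by blast
  note sub = complex_vector.subspace_diff[OF E] complex_vector.subspace_scale[OF E]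
    complex_vector.subspace_add[OF E]
  have ev: "\<exists>c. A x = c *\<^sub>C x" if "x \<in> E" for x
  proof (cases "x = 0")
    case True
    then show ?thesis
      using scale[of 0 0] by simp
  next
    case False
    define c where "c = cinner (A x) x / cinner x x"
    define d where "d = A x - c *\<^sub>C x"
    have dx: "cinner d x = 0"
      unfolding d_def c_def by (rule orthogonal_residual)
    then have xd: "cinner x d = 0"
      by (subst cinner_commute) simp
    \<comment> \<open>Since \<open>d\<close> is orthogonal to \<open>x\<close>, it is orthogonal to
      \<open>A x\<close>, and hence to itself.\<close>
    have "cinner (A x) d = 0"
      using that by (intro orth xd) (auto simp: d_def intro: sub A_E)
    then have "cinner d d = 0"
      using xd by (simp add: d_def[THEN arg_cong[where f = "\<lambda>t. cinner t d"]] cinner_simps)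
    then show ?thesis
      by (auto simp: d_def cinner_eq_zero_iff)
  qed
  obtain c where c: "A x0 = c *\<^sub>C x0"
    using ev x0 by blast
  have "A x = c *\<^sub>C x" if "x \<in> E" for x
  proof -
    define a where "a = cinner x x0 / cinner x0 x0"
    define y where "y = x - a *\<^sub>C x0"
    have yE: "y \<in> E"
      using that x0 by (auto simp: y_def intro: sub)
    have y: "cinner y x0 = 0"
      unfolding y_def a_def by (rule orthogonal_residual)
    then have y': "cinner x0 y = 0"
      by (subst cinner_commute) simp
    obtain d where d: "A y = d *\<^sub>C y"
      using ev yE by blast
    \<comment> \<open>The weights make \<open>w\<close> orthogonal to \<open>x0 + y\<close>, while
      pairing \<open>c *\<^sub>C x0 + d *\<^sub>C y\<close> with \<open>w\<close> gives a multiple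
      of \<open>c - d\<close>.\<close>
    define w where "w = cinner y y *\<^sub>C x0 - cinner x0 x0 *\<^sub>C y"
    have real: "cnj (cinner v v) = cinner v v" for v :: 'a
      by (metis cinner_commute)
    have "cinner (x0 + y) w = 0"
      by (simp add: w_def cinner_simps y y' real)
    then have "cinner (A (x0 + y)) w = 0"
      using x0 yE by (intro orth) (auto simp: w_def intro: sub)
    then have "(c - d) * (cinner x0 x0 * cinner y y) = 0"
      by (simp add: add c d w_def cinner_simps y y' real algebra_simps)
    then have "A y = c *\<^sub>C y"
      using x0 d by (auto simp: cinner_eq_zero_iff)
    moreover have "x = y + a *\<^sub>C x0"
      by (simp add: y_def)
    ultimately show ?thesis
      by (simp add: add scale c scaleC_add_right scaleC_scaleC mult.commute)
  qed
  then show ?thesis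
    using that by blast
next
  case False
  then show ?thesis
    using that[of 0] scale[of 0 0] by (metis complex_vector.scale_zero_left)
qed

subsection \<open>The decomposition into range and cokernel\<close>

locale left_invertible_operator =
  fixes T :: "'a::chilbert_space \<Rightarrow> 'a"
  assumes T_BH: "T \<in> BH" and T_left_invertible: "left_invertible T"
begin

abbreviation L :: "'a \<Rightarrow> 'a"
  where "L \<equiv> cauchy_dual_adj T"

abbreviation P :: "'a \<Rightarrow> 'a"
  where "P \<equiv> orth_proj (coker T)"

lemma obtain_left_inverse:
  obtains A where "A \<in> BH" "\<And>x. A (T x) = x"
  using T_left_invertible unfolding left_invertible_def by (metis comp_apply id_apply)

lemma T_eq_zeroD: "T x = 0 \<Longrightarrow> x = 0"
  using obtain_left_inverse BH_zero by metis

lemma subspace_coker: "complex_vector.subspace (coker T)"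
  using adj_scaleC[OF T_BH, of 0 0]
  by (simp add: complex_vector.subspace_def coker_def adj_add[OF T_BH] adj_scaleC[OF T_BH])

lemma cinner_coker [simp]: "e \<in> coker T \<Longrightarrow> cinner (T x) e = 0"
  by (simp add: cinner_adj[OF T_BH] coker_def)

lemma cinner_coker' [simp]: "e \<in> coker T \<Longrightarrow> cinner e (T x) = 0"
  by (subst cinner_commute) simp

text \<open>The range of \<open>T\<close> is the fixed-point set of the continuous map
  \<open>\<lambda>y. T (A y)\<close>, hence closed. The residual of projecting \<open>y\<close> onto
  it is orthogonal to the range, so the adjoint kills it.\<close>

lemma coker_decomposition:
  obtains x e where "y = T x + e" "e \<in> coker T"
proof -
  obtain A where A: "A \<in> BH" "\<And>x. A (T x) = x"
    using obtain_left_inverse by blast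
  have "range T = {y. T (A y) = y}"
    using A(2) by (auto intro: range_eqI[OF sym])
  moreover have "bounded_linear (\<lambda>y. T (A y))"
    using bounded_linear_compose[OF BH_bounded_linear[OF T_BH] BH_bounded_linear[OF A(1)]] .
  ultimately have "closed (range T)"
    by (simp add: closed_Collect_eq linear_continuous_on)
  moreover have "complex_vector.subspace (range T)"
    unfolding complex_vector.subspace_def
    by (auto simp flip: BH_add[OF T_BH] BH_scaleC[OF T_BH] intro: range_eqI[of _ T 0] BH_zero[OF T_BH, symmetric])
  ultimately obtain p where p: "p \<in> range T" "\<And>s. s \<in> range T \<Longrightarrow> cinner (y - p) s = 0"
    using exists_orthogonal_projection[of "range T" y] by blast
  have "adj T (y - p) = 0"
  proof (rule adj_eqI[OF T_BH])
    fix x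
    show "cinner (T x) (y - p) = cinner x 0"
      using p(2)[of "T x"] by (subst cinner_commute) simp
  qed
  then show ?thesis
    using that[of _ "y - p"] p(1) by (auto simp: coker_def)
qed

text \<open>As \<open>adj T e = 0\<close>, the \<open>inv\<close> in \<open>L\<close> is applied to
  a value of \<open>adj T \<circ> T\<close>, where injectivity lets it cancel.\<close>

lemma L_decomposition:
  assumes "e \<in> coker T"
  shows "L (T x + e) = x"
proof -
  have "inj (adj T \<circ> T)"
  proof (rule injI)
    fix x y
    assume "(adj T \<circ> T) x = (adj T \<circ> T) y"
    then have "adj T (T x - T y) = 0"
      using adj_add[OF T_BH, of "T x - T y" "T y"] by simp
    then have "cinner (T (x - y)) (T (x - y)) = 0"
      using cinner_adj[OF T_BH, of "x - y" "T (x - y)"] by (simp add: BH_diff[OF T_BH])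
    then show "x = y"
      using T_eq_zeroD[of "x - y"] by (simp add: cinner_eq_zero_iff)
  qed
  then have "inv (adj T \<circ> T) ((adj T \<circ> T) x) = x"
    by (rule inv_f_f)
  moreover have "adj T (T x + e) = (adj T \<circ> T) x"
    using assms by (simp add: adj_add[OF T_BH] coker_def)
  ultimately show ?thesis
    by (simp add: cauchy_dual_adj_def)
qed

text \<open>Two candidates for the projection differ by a vector of \<open>coker T\<close> that is
  orthogonal to itself.\<close>

lemma P_decomposition:
  assumes "e \<in> coker T"
  shows "P (T x + e) = e"
  unfolding orth_proj_def
proof (rule the_equality)
  show "e \<in> coker T \<and> (\<forall>y\<in>coker T. cinner (T x + e - e) y = 0)"
    using assms by simp
next
  fix p
  assume p: "p \<in> coker T \<and> (\<forall>y\<in>coker T. cinner (T x + e - p) y = 0)"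
  then have d: "e - p \<in> coker T"
    using assms complex_vector.subspace_diff[OF subspace_coker] by blast
  then have "cinner (T x + (e - p)) (e - p) = 0"
    using p by (simp add: add_diff_eq)
  then have "cinner (e - p) (e - p) = 0"
    using d by (simp add: cinner_add_left)
  then show "p = e"
    by (simp add: cinner_eq_zero_iff)
qed

text \<open>\<open>L\<close> and \<open>P\<close> read off the two parts of the splitting along
  \<open>range T\<close> and \<open>coker T\<close>; linearity of both then follows from its
  uniqueness.\<close>

lemma decomposition: "T (L y) + P y = y"
  and P_in_coker [simp]: "P y \<in> coker T"
  by (metis coker_decomposition L_decomposition P_decomposition)+

lemma zero_in_coker [simp]: "0 \<in> coker T"
  by (rule complex_vector.subspace_0[OF subspace_coker])

lemma L_T [simp]: "L (T x) = x" and P_T [simp]: "P (T x) = 0"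
  using L_decomposition[of 0 x] P_decomposition[of 0 x] by simp_all

lemma L_coker: "e \<in> coker T \<Longrightarrow> L e = 0" and P_coker: "e \<in> coker T \<Longrightarrow> P e = e"
  using L_decomposition[of e 0] P_decomposition[of e 0] BH_zero[OF T_BH] by simp_all

lemma L_add: "L (x + y) = L x + L y" and P_add: "P (x + y) = P x + P y"
proof -
  have "T (L x + L y) + (P x + P y) = (T (L x) + P x) + (T (L y) + P y)"
    by (simp add: BH_add[OF T_BH])
  then have "x + y = T (L x + L y) + (P x + P y)"
    by (simp add: decomposition)
  moreover have "P x + P y \<in> coker T"
    by (simp add: complex_vector.subspace_add[OF subspace_coker])
  ultimately show "L (x + y) = L x + L y" "P (x + y) = P x + P y"
    by (metis L_decomposition P_decomposition)+
qed

lemma L_scaleC: "L (c *\<^sub>C x) = c *\<^sub>C L x" and P_scaleC: "P (c *\<^sub>C x) = c *\<^sub>C P x"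
proof -
  have "c *\<^sub>C x = T (c *\<^sub>C L x) + c *\<^sub>C P x"
    by (metis decomposition scaleC_add_right BH_scaleC[OF T_BH])
  moreover have "c *\<^sub>C P x \<in> coker T"
    by (simp add: complex_vector.subspace_scale[OF subspace_coker])
  ultimately show "L (c *\<^sub>C x) = c *\<^sub>C L x" "P (c *\<^sub>C x) = c *\<^sub>C P x"
    by (metis L_decomposition P_decomposition)+
qed

lemma norm_P_le: "norm (P x) \<le> norm x" and norm_T_L_le: "norm (T (L x)) \<le> norm x"
proof -
  have "(norm x)\<^sup>2 = (norm (T (L x)))\<^sup>2 + (norm (P x))\<^sup>2"
    using norm_sq_add[of "T (L x)" "P x"] by (simp add: decomposition)
  then show "norm (P x) \<le> norm x" "norm (T (L x)) \<le> norm x"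
    by (simp_all add: power2_le_imp_le)
qed

text \<open>With a bounded left inverse \<open>A\<close> of \<open>T\<close>,
  \<open>L x = A (T (L x))\<close>, and \<open>T (L x)\<close> is no longer than
  \<open>x\<close>.\<close>

lemma L_BH: "L \<in> BH"
proof -
  obtain A where A: "A \<in> BH" "\<And>x. A (T x) = x"
    using obtain_left_inverse by blast
  obtain K where K: "K > 0" "\<And>x. norm (A x) \<le> K * norm x"
    by (rule BH_bound[OF A(1)]) blast
  have "norm (L x) \<le> K * norm x" for x
    using order_trans[OF K(2)[of "T (L x)"] mult_left_mono[OF norm_T_L_le]] K(1) A(2) by simp
  then show ?thesis
    unfolding BH_iff using L_add L_scaleC by blast
qed

subsection \<open>Coefficients and evaluation functionals\<close>

text \<open>These are the Taylor coefficients of the model function of \<open>f\<close>, taken on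
  the Hilbert space itself so that they can be studied before the model map is known to be
  injective.\<close>

definition coeff :: "'a \<Rightarrow> nat \<Rightarrow> 'a"
  where "coeff f n = P ((L ^^ n) f)"

lemma coeff_in_coker [simp]: "coeff f n \<in> coker T"
  by (simp add: coeff_def)

lemma coeff_add: "coeff (f + g) n = coeff f n + coeff g n"
proof -
  have "(L ^^ n) (f + g) = (L ^^ n) f + (L ^^ n) g"
    by (induction n) (simp_all add: L_add)
  then show ?thesis
    by (simp add: coeff_def P_add)
qed

lemma coeff_scaleC: "coeff (c *\<^sub>C f) n = c *\<^sub>C coeff f n"
proof -
  have "(L ^^ n) (c *\<^sub>C f) = c *\<^sub>C (L ^^ n) f"
    by (induction n) (simp_all add: L_scaleC)
  then show ?thesis
    by (simp add: coeff_def P_scaleC)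
qed

text \<open>Vectors of \<open>coker T\<close> correspond to constant functions.\<close>

lemma coeff_coker:
  assumes "e \<in> coker T"
  shows "coeff e n = (if n = 0 then e else 0)"
proof (cases n)
  case (Suc m)
  have "(L ^^ m) 0 = 0"
    by (induction m) (simp_all add: BH_zero[OF L_BH])
  then show ?thesis
    using Suc P_coker[of 0] by (simp add: coeff_def funpow_Suc_right L_coker[OF assms] del: funpow.simps)
qed (simp add: coeff_def P_coker[OF assms])

text \<open>A radius with a coefficient estimate uniform in \<open>f\<close>. Any disc around 0
  suffices for comparing power series coefficients, so the spectral radius does not enter.\<close>

definition rho :: real
  where "rho = (SOME s. s > 0 \<and> (\<forall>f n. norm (coeff f n) * s ^ n \<le> norm f))"

text \<open>If \<open>K\<close> bounds \<open>L\<close>, the radius \<open>1 / K\<close> qualifies,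
  because \<open>L ^^ n\<close> is bounded by \<open>K ^ n\<close> and \<open>P\<close> does not
  increase norms.\<close>

lemma rho_pos: "rho > 0" and norm_coeff_le: "norm (coeff f n) * rho ^ n \<le> norm f"
proof -
  obtain K where K: "K > 0" "\<And>x. norm (L x) \<le> K * norm x"
    by (rule BH_bound[OF L_BH]) blast
  have L_pow: "norm ((L ^^ n) f) \<le> K ^ n * norm f" for f n
  proof (induction n)
    case (Suc n)
    show ?case
      using order_trans[OF K(2)[of "(L ^^ n) f"] mult_left_mono[OF Suc]] K(1)
      by (simp add: mult.assoc)
  qed simp
  have "norm (coeff f n) * (1 / K) ^ n \<le> norm f" for f n
    using order_trans[OF norm_P_le L_pow[where f = f and n = n]] K(1)
    by (simp add: coeff_def power_one_over field_simps)
  then have "\<exists>s>0. \<forall>f n. norm (coeff f n) * s ^ n \<le> norm f"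
    using K(1) by (intro exI[of _ "1 / K"]) simp
  then have "rho > 0 \<and> (\<forall>f n. norm (coeff f n) * rho ^ n \<le> norm f)"
    unfolding rho_def by (rule someI_ex)
  then show "rho > 0" "norm (coeff f n) * rho ^ n \<le> norm f"
    by blast+
qed

lemma norm_coeff_powser_le: "norm (coeff f n) * cmod z ^ n \<le> norm f * (cmod z / rho) ^ n"
proof -
  have "norm (coeff f n) * cmod z ^ n = (norm (coeff f n) * rho ^ n) * (cmod z / rho) ^ n"
    using rho_pos by (simp add: power_divide)
  also have "\<dots> \<le> norm f * (cmod z / rho) ^ n"
    using rho_pos by (intro mult_right_mono norm_coeff_le) simp
  finally show ?thesis .
qed

lemma summable_norm_coeff:
  assumes "cmod z < rho"
  shows "summable (\<lambda>n. norm (coeff f n) * cmod z ^ n)"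
proof (rule summable_comparison_test')
  show "summable (\<lambda>n. norm f * (cmod z / rho) ^ n)"
    using assms rho_pos by (intro summable_mult summable_geometric) simp
  show "norm (norm (coeff f n) * cmod z ^ n) \<le> norm f * (cmod z / rho) ^ n" if "n \<ge> 0" for n
    using norm_coeff_powser_le by simp
qed

text \<open>The scalar function \<open>\<langle>(U f)(z), e\<rangle>\<close>.\<close>

definition eval_cinner :: "'a \<Rightarrow> complex \<Rightarrow> 'a \<Rightarrow> complex"
  where "eval_cinner e z f = (\<Sum>n. cinner (coeff f n) e * z ^ n)"

lemma norm_eval_term_le:
  "cmod (cinner (coeff f n) e * z ^ n) \<le> norm e * (norm (coeff f n) * cmod z ^ n)"
  using mult_right_mono[OF Cauchy_Schwarz_cinner[of "coeff f n" e], of "cmod z ^ n"]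
  by (simp add: norm_mult norm_power mult_ac)

lemma abs_summable_eval:
  assumes "cmod z < rho"
  shows "summable (\<lambda>n. cmod (cinner (coeff f n) e * z ^ n))"
  by (rule summable_comparison_test'[OF summable_mult[OF summable_norm_coeff[OF assms], of "norm e" f]])
    (use norm_eval_term_le in simp)

lemma eval_sums:
  "cmod z < rho \<Longrightarrow> (\<lambda>n. cinner (coeff f n) e * z ^ n) sums eval_cinner e z f"
  unfolding eval_cinner_def by (rule summable_sums[OF summable_norm_cancel[OF abs_summable_eval]])

lemma eval_cinner_add:
  assumes "cmod z < rho"
  shows "eval_cinner e z (f + g) = eval_cinner e z f + eval_cinner e z g"
  using sums_add[OF eval_sums[OF assms, of f e] eval_sums[OF assms, of g e]]
    sums_unique2[OF eval_sums[OF assms, of "f + g" e]]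
  by (simp add: coeff_add cinner_add_left distrib_right)

lemma eval_cinner_scaleC:
  assumes "cmod z < rho"
  shows "eval_cinner e z (c *\<^sub>C f) = c * eval_cinner e z f"
  using sums_mult[OF eval_sums[OF assms, of f e], of c]
    sums_unique2[OF eval_sums[OF assms, of "c *\<^sub>C f" e]]
  by (simp add: coeff_scaleC cinner_scaleC_left mult.assoc)

lemma eval_cinner_coker:
  assumes "x \<in> coker T"
  shows "eval_cinner e z x = cinner x e"
proof -
  have "(\<lambda>n. cinner (coeff x n) e * z ^ n) = (\<lambda>n. if n = 0 then cinner x e else 0)"
    by (simp add: coeff_coker[OF assms] fun_eq_iff)
  then show ?thesis
    unfolding eval_cinner_def using sums_unique[OF sums_single[of 0 "\<lambda>_. cinner x e"]] by simp
qed

lemma eval_cinner_bound: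
  assumes "cmod z < rho"
  shows "cmod (eval_cinner e z f) \<le> (norm e * (1 / (1 - cmod z / rho))) * norm f"
proof -
  have q: "norm (cmod z / rho) < 1"
    using assms rho_pos by simp
  have "cmod (eval_cinner e z f) \<le> (\<Sum>n. cmod (cinner (coeff f n) e * z ^ n))"
    unfolding eval_cinner_def by (rule summable_norm[OF abs_summable_eval[OF assms]])
  also have "\<dots> \<le> (\<Sum>n. norm e * norm f * (cmod z / rho) ^ n)"
  proof (rule suminf_le)
    fix n
    show "cmod (cinner (coeff f n) e * z ^ n) \<le> norm e * norm f * (cmod z / rho) ^ n"
      using order_trans[OF norm_eval_term_le mult_left_mono[OF norm_coeff_powser_le]]
      by (simp add: mult.assoc)
  next
    show "summable (\<lambda>n. norm e * norm f * (cmod z / rho) ^ n)"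
      by (rule summable_mult[OF summable_geometric[OF q]])
  qed (rule abs_summable_eval[OF assms])
  also have "\<dots> = norm e * norm f * (1 / (1 - cmod z / rho))"
    by (simp only: suminf_mult[OF summable_geometric[OF q]] suminf_geometric[OF q])
  finally show ?thesis
    by (simp add: mult_ac)
qed

text \<open>Boundedness of the evaluation functional makes its kernel closed, so only invariance
  remains to be checked for membership in \<open>Lat\<close>.\<close>

lemma eval_kernel:
  assumes "cmod z < rho"
  shows "complex_vector.subspace {f. eval_cinner e z f = 0}" "closed {f. eval_cinner e z f = 0}"
proof -
  have "eval_cinner e z 0 = 0"
    using eval_cinner_scaleC[OF assms, of e 0 0] by simp
  then show "complex_vector.subspace {f. eval_cinner e z f = 0}"
    by (simp add: complex_vector.subspace_def eval_cinner_add[OF assms] eval_cinner_scaleC[OF assms])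
  have "bounded_linear (eval_cinner e z)"
    by (rule bounded_linear_if_complex_linear[OF _ _ eval_cinner_bound[OF assms]])
      (simp_all add: eval_cinner_add[OF assms] eval_cinner_scaleC[OF assms] scaleC_complex_def)
  then show "closed {f. eval_cinner e z f = 0}"
    by (intro closed_Collect_eq) (auto intro: linear_continuous_on)
qed

text \<open>By the Cauchy product, convolution multiplies the evaluation at \<open>z\<close> by the
  number \<Sum> \<open>c k * z ^ k\<close>, so a zero stays a zero.\<close>

lemma eval_cinner_convolution:
  assumes z: "cmod z < rho" and e: "e \<in> coker T"
    and B: "\<And>f n. coeff (B f) n = (\<Sum>k\<le>n. c k *\<^sub>C coeff f (n - k))"
    and 0: "eval_cinner e z f = 0"
  shows "eval_cinner e z (B f) = 0"
proof (cases "e = 0")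
  case True
  then show ?thesis
    by (simp add: eval_cinner_def)
next
  case False
  \<comment> \<open>Applying \<open>B\<close> to the constant \<open>e\<close> isolates the sequence
    \<open>c\<close>; the series of \<open>B e\<close> then shows that the power series of
    \<open>c\<close> converges absolutely at \<open>z\<close>.\<close>
  have "coeff (B e) k = c k *\<^sub>C e" for k
    unfolding B by (subst sum.remove[of _ k]) (auto simp: coeff_coker[OF e] intro!: sum.neutral)
  then have "summable (\<lambda>k. cmod (cinner e e * (c k * z ^ k)))"
    using abs_summable_eval[OF z, of "B e" e] by (simp add: cinner_scaleC_left mult_ac)
  then have "summable (\<lambda>k. cmod (c k * z ^ k))"
    using False by (simp add: norm_mult cinner_eq_zero_iff summable_cmult_iff)
  then have "(\<lambda>n. \<Sum>k\<le>n. (c k * z ^ k) * (cinner (coeff f (n - k)) e * z ^ (n - k))) sums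
      ((\<Sum>k. c k * z ^ k) * eval_cinner e z f)"
    unfolding eval_cinner_def by (rule Cauchy_product_sums[OF _ abs_summable_eval[OF z]])
  moreover have "(\<Sum>k\<le>n. (c k * z ^ k) * (cinner (coeff f (n - k)) e * z ^ (n - k))) =
      cinner (coeff (B f) n) e * z ^ n" for n
    unfolding B cinner_sum_left sum_distrib_right
    by (rule sum.cong) (simp_all add: cinner_scaleC_left power_add[symmetric] mult_ac)
  ultimately show ?thesis
    using 0 by (simp add: sums_iff eval_cinner_def)
qed

text \<open>\<open>\<langle>(U A f)(z), e\<rangle>\<close> is a multiple of \<open>\<langle>(U f)(z), e\<rangle>\<close>, and the factor is read off at \<open>f = e\<close>.\<close>

lemma cinner_coeff_if_preserves_kernels:
  assumes A: "A \<in> BH" and e: "e \<in> coker T"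
    and kernel: "\<And>z f. cmod z < rho \<Longrightarrow> eval_cinner e z f = 0 \<Longrightarrow> eval_cinner e z (A f) = 0"
  shows "cinner e e * cinner (coeff (A f) n) e =
    (\<Sum>k\<le>n. cinner (coeff (A e) k) e * cinner (coeff f (n - k)) e)"
proof (rule powser_eqD[OF rho_pos])
  fix z
  assume z: "cmod z < rho"
  note lin = eval_cinner_add[OF z] eval_cinner_scaleC[OF z]
  \<comment> \<open>Evaluation at \<open>e\<close> gives \<open>cinner e e\<close>, so this
    combination of \<open>f\<close> and \<open>e\<close> lies in the kernel.\<close>
  have "eval_cinner e z (cinner e e *\<^sub>C f + (- eval_cinner e z f) *\<^sub>C e) = 0"
    unfolding lin eval_cinner_coker[OF e] by simp
  then have "eval_cinner e z (A (cinner e e *\<^sub>C f + (- eval_cinner e z f) *\<^sub>C e)) = 0"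
    by (rule kernel[OF z])
  then have eq: "cinner e e * eval_cinner e z (A f) = eval_cinner e z (A e) * eval_cinner e z f"
    by (simp only: BH_add[OF A] BH_scaleC[OF A] lin) (simp add: mult.commute)
  show "(\<lambda>n. (cinner e e * cinner (coeff (A f) n) e) * z ^ n) sums
      (cinner e e * eval_cinner e z (A f))"
    using sums_mult[OF eval_sums[OF z, of "A f" e], of "cinner e e"] by (simp add: mult.assoc)
  \<comment> \<open>A second expansion of the same function, as a Cauchy product.\<close>
  have "(\<lambda>n. \<Sum>k\<le>n. (cinner (coeff (A e) k) e * z ^ k) * (cinner (coeff f (n - k)) e * z ^ (n - k)))
      sums (cinner e e * eval_cinner e z (A f))"
    unfolding eq unfolding eval_cinner_def by (intro Cauchy_product_sums abs_summable_eval z)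
  moreover have "(\<Sum>k\<le>n. (cinner (coeff (A e) k) e * z ^ k) * (cinner (coeff f (n - k)) e * z ^ (n - k)))
      = (\<Sum>k\<le>n. cinner (coeff (A e) k) e * cinner (coeff f (n - k)) e) * z ^ n" for n
    unfolding sum_distrib_right
    by (rule sum.cong) (simp_all add: power_add[symmetric] mult_ac)
  ultimately show "(\<lambda>n. (\<Sum>k\<le>n. cinner (coeff (A e) k) e * cinner (coeff f (n - k)) e) * z ^ n) sums
      (cinner e e * eval_cinner e z (A f))"
    by simp
qed

text \<open>The identity \<open>key\<close> is used twice: orthogonal pairs in
  \<open>coker T\<close> show that each coefficient map is scalar there, and a well-chosen test
  vector then extends the formula to all \<open>f\<close>.\<close>

lemma convolution_if_preserves_kernels:
  assumes A: "A \<in> BH"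
    and kernel: "\<And>e z f. e \<in> coker T \<Longrightarrow> cmod z < rho \<Longrightarrow> eval_cinner e z f = 0 \<Longrightarrow>
      eval_cinner e z (A f) = 0"
  obtains c where "\<And>f n. coeff (A f) n = (\<Sum>k\<le>n. c k *\<^sub>C coeff f (n - k))"
proof -
  have key: "cinner e e * cinner (coeff (A f) n) e =
      (\<Sum>k\<le>n. cinner (coeff (A e) k) e * cinner (coeff f (n - k)) e)" if "e \<in> coker T" for e f n
    by (rule cinner_coeff_if_preserves_kernels[OF A that kernel[OF that]])
  have "\<exists>c. \<forall>x\<in>coker T. coeff (A x) n = c *\<^sub>C x" for n
  proof -
    have "cinner (coeff (A x) n) e = 0"
      if "x \<in> coker T" "e \<in> coker T" "cinner x e = 0" for x e
    proof -
      have "cinner (coeff x m) e = 0" for m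
        using that by (simp add: coeff_coker)
      then have "cinner e e * cinner (coeff (A x) n) e = 0"
        using key[of e x n] that(2) by simp
      then show ?thesis
        by (auto simp: cinner_eq_zero_iff)
    qed
    then obtain c where "\<And>x. x \<in> coker T \<Longrightarrow> coeff (A x) n = c *\<^sub>C x"
      using scalar_if_preserves_orthogonality[OF subspace_coker, of "\<lambda>x. coeff (A x) n"]
      by (auto simp: BH_add[OF A] BH_scaleC[OF A] coeff_add coeff_scaleC)
    then show ?thesis
      by blast
  qed
  then obtain c where c: "\<And>n x. x \<in> coker T \<Longrightarrow> coeff (A x) n = c n *\<^sub>C x"
    by metis
  have "coeff (A f) n = (\<Sum>k\<le>n. c k *\<^sub>C coeff f (n - k))" for f n
  proof -
    define s where "s = (\<Sum>k\<le>n. c k *\<^sub>C coeff f (n - k))"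
    \<comment> \<open>The error itself serves as test vector in \<open>key\<close>; since
      \<open>A\<close> acts on \<open>d\<close> through the scalars \<open>c\<close>, the error is
      orthogonal to itself.\<close>
    define d where "d = coeff (A f) n - s"
    have "s \<in> coker T"
      unfolding s_def using subspace_coker
      by (intro complex_vector.subspace_sum complex_vector.subspace_scale) auto
    then have d: "d \<in> coker T"
      unfolding d_def by (intro complex_vector.subspace_diff[OF subspace_coker]) auto
    have "cinner d d * cinner (coeff (A f) n) d = cinner d d * cinner s d"
      unfolding s_def key[OF d, of f n]
      by (simp add: c[OF d] cinner_simps cinner_sum_left sum_distrib_left mult_ac)
    then have "cinner d d * cinner d d = 0"
      by (simp add: d_def[THEN arg_cong[where f = "\<lambda>t. cinner t d"]] cinner_diff_left)
    then show ?thesis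
      by (simp add: d_def cinner_eq_zero_iff s_def)
  qed
  then show ?thesis
    using that by blast
qed

end

subsection \<open>Spectral bounds\<close>

text \<open>Banach's fixed point theorem solves \<open>A x - c *\<^sub>C x = y\<close> uniquely, and
  the solution operator is bounded by \<open>1 / (cmod c - K)\<close>. This bounds the set whose
  supremum is the spectral radius.\<close>

lemma notin_spectrum_if_large:
  fixes A :: "'a::chilbert_space \<Rightarrow> 'a"
  assumes A: "A \<in> BH" and bound: "\<And>x. norm (A x) \<le> K * norm x" and "K > 0" and c: "cmod c > K"
  shows "c \<notin> spectrum A"
proof -
  have c0: "c \<noteq> 0"
    using c \<open>K > 0\<close> by auto
  have contraction: "K / cmod c < 1" "0 \<le> K / cmod c"
    using c \<open>K > 0\<close> by (simp_all add: divide_less_eq)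
  have "\<exists>!x. inverse c *\<^sub>C (A x - y) = x" for y
  proof -
    have "dist (inverse c *\<^sub>C (A u - y)) (inverse c *\<^sub>C (A v - y)) \<le> K / cmod c * dist u v" for u v
    proof -
      have "inverse c *\<^sub>C (A u - y) - inverse c *\<^sub>C (A v - y) = inverse c *\<^sub>C A (u - v)"
        by (simp only: complex_vector.scale_right_diff_distrib[symmetric] BH_diff[OF A]) simp
      then have "dist (inverse c *\<^sub>C (A u - y)) (inverse c *\<^sub>C (A v - y)) =
          inverse (cmod c) * norm (A (u - v))"
        by (simp only: dist_norm norm_scaleC norm_inverse)
      also have "\<dots> \<le> inverse (cmod c) * (K * norm (u - v))"
        by (intro mult_left_mono bound) simp
      finally show ?thesis
        by (simp add: dist_norm field_simps)
    qed
    then show ?thesis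
      using banach_fix_type[of "K / cmod c" "\<lambda>x. inverse c *\<^sub>C (A x - y)"] contraction by blast
  qed
  moreover have "inverse c *\<^sub>C (A x - y) = x \<longleftrightarrow> A x - c *\<^sub>C x = y" for x y
  proof
    assume "inverse c *\<^sub>C (A x - y) = x"
    then have "c *\<^sub>C inverse c *\<^sub>C (A x - y) = c *\<^sub>C x"
      by simp
    then have "A x - y = c *\<^sub>C x"
      using c0 by (simp add: scaleC_scaleC scaleC_one)
    then show "A x - c *\<^sub>C x = y"
      by (simp add: algebra_simps)
  next
    assume "A x - c *\<^sub>C x = y"
    then have "A x - y = c *\<^sub>C x"
      by auto
    then show "inverse c *\<^sub>C (A x - y) = x"
      using c0 by (simp add: scaleC_scaleC scaleC_one)
  qed
  ultimately have ex1: "\<exists>!x. A x - c *\<^sub>C x = y" for y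
    by simp
  define B where "B y = (THE x. A x - c *\<^sub>C x = y)" for y
  have B: "A (B y) - c *\<^sub>C B y = y" for y
    unfolding B_def by (rule theI'[OF ex1])
  have BI: "A x - c *\<^sub>C x = y \<Longrightarrow> B y = x" for x y
    using ex1[of y] B[of y] by blast
  have "B (x + y) = B x + B y" for x y
  proof (rule BI)
    have "A (B x + B y) - c *\<^sub>C (B x + B y) = (A (B x) - c *\<^sub>C B x) + (A (B y) - c *\<^sub>C B y)"
      by (simp add: BH_add[OF A] scaleC_add_right)
    then show "A (B x + B y) - c *\<^sub>C (B x + B y) = x + y"
      by (simp add: B)
  qed
  moreover have "B (a *\<^sub>C x) = a *\<^sub>C B x" for a x
  proof (rule BI)
    have "A (a *\<^sub>C B x) - c *\<^sub>C a *\<^sub>C B x = a *\<^sub>C (A (B x) - c *\<^sub>C B x)"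
      by (simp add: BH_scaleC[OF A] complex_vector.scale_right_diff_distrib scaleC_scaleC mult.commute)
    then show "A (a *\<^sub>C B x) - c *\<^sub>C a *\<^sub>C B x = a *\<^sub>C x"
      by (simp add: B)
  qed
  moreover have "norm (B x) \<le> 1 / (cmod c - K) * norm x" for x
  proof -
    have "c *\<^sub>C B x = A (B x) - x"
      using B[of x] by (simp add: algebra_simps)
    then have "cmod c * norm (B x) \<le> K * norm (B x) + norm x"
      using norm_triangle_ineq4[of "A (B x)" x] bound[of "B x"] by (simp flip: norm_scaleC)
    then show ?thesis
      using c by (simp add: field_simps)
  qed
  ultimately have "B \<in> BH"
    unfolding BH_iff by blast
  moreover have "B (A x - c *\<^sub>C x) = x" for x
    by (rule BI) simp
  ultimately show ?thesis
    unfolding spectrum_def using B by blast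
qed

lemma eigenvalue_in_spectrum:
  assumes "A x = c *\<^sub>C x" "x \<noteq> 0"
  shows "c \<in> spectrum A"
proof -
  have False if "B \<in> BH" "B (A x - c *\<^sub>C x) = x" for B
    using that assms BH_zero[OF that(1)] by simp
  then show ?thesis
    unfolding spectrum_def by blast
qed

locale left_invertible_analytic_operator = left_invertible_operator +
  assumes analytic: "analytic T"
begin

text \<open>If all coefficients of \<open>d\<close> vanish, then
  \<open>d = (T ^^ n) ((L ^^ n) d)\<close> for every \<open>n\<close>, so \<open>d\<close> lies in
  all ranges and analyticity forces \<open>d = 0\<close>.\<close>

lemma coeff_eq_iff: "coeff f = coeff g \<longleftrightarrow> f = g"
proof
  assume eq: "coeff f = coeff g"
  define d where "d = f + (- 1) *\<^sub>C g"
  have "coeff d n = 0" for n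
    unfolding d_def coeff_add coeff_scaleC eq by simp
  then have step: "T ((L ^^ Suc n) d) = (L ^^ n) d" for n
    using decomposition[of "(L ^^ n) d"] by (simp add: coeff_def)
  have "(T ^^ n) ((L ^^ n) d) = d" for n
  proof (induction n)
    case (Suc n)
    then show ?case
      by (simp only: funpow_Suc_right[of n T] o_apply step)
  qed simp
  then have "d \<in> (\<Inter>n. range (T ^^ n))"
    by (metis INT_I rangeI)
  then have "d = 0"
    using analytic unfolding analytic_def by blast
  then show "f = g"
    by (simp add: d_def flip: uminus_eq_scaleC)
qed simp

end

subsection \<open>Operator algebras\<close>

text \<open>This makes \<open>BH\<close> one of the sets intersected in
  \<open>wot_algebra\<close>.\<close>

lemma BH_closed_subalgebra:
  shows "subalgebra (BH :: ('a::complex_inner \<Rightarrow> 'a) set)"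
    and "closedin weak_operator_topology (BH :: ('a \<Rightarrow> 'a) set)"
proof -
  have "(\<lambda>x. A x + B x) \<in> BH" "A \<circ> B \<in> BH"
    if AB: "A \<in> BH" "B \<in> BH" for A B :: "'a \<Rightarrow> 'a"
  proof -
    obtain K where K: "K > 0" "\<And>x. norm (A x) \<le> K * norm x"
      by (rule BH_bound[OF AB(1)]) blast
    obtain M where M: "M > 0" "\<And>x. norm (B x) \<le> M * norm x"
      by (rule BH_bound[OF AB(2)]) blast
    have "norm (A x + B x) \<le> (K + M) * norm x" for x
      using norm_triangle_ineq[of "A x" "B x"] K(2)[of x] M(2)[of x] by (simp add: distrib_right)
    moreover have "norm (A (B x)) \<le> (K * M) * norm x" for x
      using order_trans[OF K(2)[of "B x"] mult_left_mono[OF M(2)]] K(1) by (simp add: mult.assoc)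
    ultimately show "(\<lambda>x. A x + B x) \<in> BH" "A \<circ> B \<in> BH"
      unfolding BH_iff using AB by (auto simp: BH_add BH_scaleC scaleC_add_right add_ac)
  qed
  moreover have "(\<lambda>x. c *\<^sub>C A x) \<in> BH" if A: "A \<in> BH" for A :: "'a \<Rightarrow> 'a" and c
  proof -
    obtain K where K: "K > 0" "\<And>x. norm (A x) \<le> K * norm x"
      by (rule BH_bound[OF A]) blast
    have "norm (c *\<^sub>C A x) \<le> (cmod c * K) * norm x" for x
      using mult_left_mono[OF K(2), of "cmod c" x] by (simp add: norm_scaleC mult.assoc)
    then show ?thesis
      unfolding BH_iff using A
      by (auto simp: BH_add BH_scaleC scaleC_add_right scaleC_scaleC mult.commute[of c])
  qed
  moreover have "(\<lambda>x. 0) \<in> (BH :: ('a \<Rightarrow> 'a) set)"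
    unfolding BH_iff by (auto intro: exI[of _ 0])
  ultimately show "subalgebra (BH :: ('a \<Rightarrow> 'a) set)"
    by (simp add: subalgebra_def)
  have "{A \<in> BH. cinner (A x) y \<in> V} \<subseteq> BH" for x y :: 'a and V
    by blast
  \<comment> \<open>The choice \<open>V = UNIV\<close> gives all of \<open>BH\<close> as a subbasic
    set, so \<open>BH\<close> is the whole space of the topology.\<close>
  moreover have "BH \<in> {{A \<in> BH. cinner (A x) y \<in> V} | x (y::'a) V. open V}"
    by (intro CollectI exI[of _ 0] exI[of _ UNIV]) simp
  ultimately have "topspace weak_operator_topology = (BH :: ('a \<Rightarrow> 'a) set)"
    unfolding weak_operator_topology_def topology_generated_by_topspace by blast
  then show "closedin weak_operator_topology (BH :: ('a \<Rightarrow> 'a) set)"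
    by (metis closedin_topspace)
qed

lemma wot_algebra_subset_BH:
  assumes "T \<in> BH"
  shows "wot_algebra T \<subseteq> BH"
proof -
  have "id \<in> BH"
    unfolding BH_iff by (auto intro: exI[of _ 1])
  then show ?thesis
    unfolding wot_algebra_def using assms BH_closed_subalgebra by blast
qed

text \<open>The half of reflexivity that is automatic.\<close>

lemma subset_Alg_Lat: "W \<subseteq> BH \<Longrightarrow> W \<subseteq> Alg (Lat W)"
  unfolding Alg_def Lat_def by blast

subsection \<open>The analytic model and its scalar multipliers\<close>

context left_invertible_analytic_operator
begin

text \<open>For small \<open>c\<close> and \<open>e \<in> coker T\<close>, the fixed point \<open>x = e + c T x\<close> satisfies \<open>L x = c x\<close>, so
  \<open>L\<close> has nonzero eigenvalues and \<open>model_radius T\<close> is not the junk value \<open>1 / 0 = 0\<close>.\<close>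

lemma model_radius_pos:
  assumes "\<exists>x::'a. x \<noteq> 0"
  shows "model_radius T > 0"
proof -
  \<comment> \<open>If \<open>coker T\<close> were trivial, all coefficients would vanish and the
    space would be zero.\<close>
  obtain e where e: "e \<in> coker T" "e \<noteq> 0"
  proof (rule ccontr)
    assume "\<not> thesis"
    then have "coeff f = coeff 0" for f
      using that by (metis coeff_in_coker ext)
    then show False
      using assms by (simp add: coeff_eq_iff)
  qed
  obtain M where M: "M > 0" "\<And>x. norm (T x) \<le> M * norm x"
    by (rule BH_bound[OF T_BH]) blast
  \<comment> \<open>This size makes \<open>\<lambda>x. e + c *\<^sub>C T x\<close> a contraction
    with factor \<open>1 / 2\<close>.\<close>
  define c where "c = complex_of_real (1 / (2 * M))"
  have "dist (e + c *\<^sub>C T u) (e + c *\<^sub>C T v) \<le> 1 / 2 * dist u v" for u v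
  proof -
    have "dist (e + c *\<^sub>C T u) (e + c *\<^sub>C T v) = 1 / (2 * M) * norm (T (u - v))"
      using M(1) by (simp add: dist_norm norm_scaleC c_def BH_diff[OF T_BH] norm_divide norm_mult
          complex_vector.scale_right_diff_distrib[symmetric])
    also have "\<dots> \<le> 1 / (2 * M) * (M * norm (u - v))"
      using M(1) by (intro mult_left_mono M) simp
    finally show ?thesis
      using M(1) by (simp add: dist_norm)
  qed
  then obtain x where x: "e + c *\<^sub>C T x = x"
    using banach_fix_type[of "1 / 2" "\<lambda>x. e + c *\<^sub>C T x"] by auto
  have "x \<noteq> 0"
    using x e(2) by (auto simp: BH_zero[OF T_BH])
  moreover have "L x = c *\<^sub>C x"
    by (subst x[symmetric]) (simp add: L_add L_scaleC L_coker[OF e(1)])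
  ultimately have c: "c \<in> spectrum L"
    by (intro eigenvalue_in_spectrum)
  obtain K where K: "K > 0" "\<And>x. norm (L x) \<le> K * norm x"
    by (rule BH_bound[OF L_BH]) blast
  \<comment> \<open>The real supremum dominates the members of a set only when that set is bounded
    above.\<close>
  have "bdd_above (cmod ` spectrum L)"
    using notin_spectrum_if_large[OF L_BH K(2) K(1)] by (intro bdd_aboveI[of _ K]) force
  then have "cmod c \<le> spectral_radius L"
    unfolding spectral_radius_def by (rule cSUP_upper[OF c])
  moreover have "cmod c > 0"
    using M(1) by (simp add: c_def)
  ultimately have "spectral_radius L > 0"
    by linarith
  then show ?thesis
    unfolding model_radius_def by simp
qed

text \<open>Inside \<open>rho\<close> the series converges absolutely; inside
  \<open>model_radius T\<close> the function \<open>model_U T f\<close> is given by the series and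
  not by its default value 0.\<close>

lemma cinner_model_U:
  assumes "cmod z < rho" "cmod z < model_radius T"
  shows "cinner (model_U T f z) e = eval_cinner e z f"
proof -
  have "(\<lambda>n. norm (z ^ n *\<^sub>C coeff f n)) = (\<lambda>n. norm (coeff f n) * cmod z ^ n)"
    by (simp add: norm_scaleC norm_power mult.commute)
  then have "summable (\<lambda>n. norm (z ^ n *\<^sub>C coeff f n))"
    using summable_norm_coeff[OF assms(1)] by simp
  then have "(\<lambda>n. z ^ n *\<^sub>C coeff f n) sums model_U T f z"
    using assms(2) summable_sums[OF summable_norm_cancel, of "\<lambda>n. z ^ n *\<^sub>C coeff f n"]
    by (simp add: model_U_def coeff_def)
  moreover have "cmod (cinner x e) \<le> norm e * norm x" for x
    using Cauchy_Schwarz_cinner[of x e] by (simp add: mult.commute)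
  then have "bounded_linear (\<lambda>x. cinner x e)"
    by (rule bounded_linear_if_complex_linear[rotated 2])
      (simp_all add: cinner_simps scaleC_complex_def)
  ultimately have "(\<lambda>n. cinner (z ^ n *\<^sub>C coeff f n) e) sums cinner (model_U T f z) e"
    using bounded_linear.sums by blast
  then show ?thesis
    unfolding eval_cinner_def by (simp add: sums_iff cinner_scaleC_left mult.commute)
qed

text \<open>Power series uniqueness on the smaller of the two discs recovers all coefficients, and
  these determine the vector.\<close>

lemma inj_model_U:
  assumes "\<exists>x::'a. x \<noteq> 0"
  shows "inj (model_U T)"
proof (rule injI)
  fix f g
  assume eq: "model_U T f = model_U T g"
  have "coeff f n = coeff g n" for n
  proof (rule eq_if_cinner_eq)
    fix e
    show "cinner (coeff f n) e = cinner (coeff g n) e"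
    proof (rule powser_eqD[of "min rho (model_radius T)"])
      show "min rho (model_radius T) > 0"
        using rho_pos model_radius_pos[OF assms] by simp
      fix z
      assume z: "cmod z < min rho (model_radius T)"
      then show "(\<lambda>n. cinner (coeff f n) e * z ^ n) sums eval_cinner e z f"
        by (intro eval_sums) simp
      have "eval_cinner e z f = eval_cinner e z g"
        using z cinner_model_U eq by (metis min_less_iff_conj)
      then show "(\<lambda>n. cinner (coeff g n) e * z ^ n) sums eval_cinner e z f"
        using z eval_sums[of z g e] by simp
    qed
  qed
  then show "f = g"
    using coeff_eq_iff by blast
qed

text \<open>The inner product is transported along an injective map, so the adjoint is the inverse
  on the model space.\<close>

lemma model_U_adj_model_U:
  assumes "\<exists>x::'a. x \<noteq> 0"
  shows "model_U_adj T (model_U T f) = f"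
proof -
  have "(\<forall>x. model_cinner T (model_U T x) (model_U T f) = cinner x h) \<longleftrightarrow> h = f" for h
    unfolding model_cinner_def inv_f_f[OF inj_model_U[OF assms]]
    by (metis cinner_commute eq_if_cinner_eq)
  then show ?thesis
    unfolding model_U_adj_def by simp
qed

lemma taylor_coeff_model_U:
  assumes "\<exists>x::'a. x \<noteq> 0"
  shows "taylor_coeff T (model_U T f) = coeff f"
  by (simp add: taylor_coeff_def coeff_def model_U_adj_model_U[OF assms] fun_eq_iff)

section \<open>Scalar multipliers as scalar convolutions\<close>

lemma mult_op_model_U:
  assumes "\<exists>x::'a. x \<noteq> 0" "conv \<phi> (coeff f) = coeff h"
  shows "mult_op T \<phi> (model_U T f) = model_U T h"
  unfolding mult_op_def
  by (rule the_equality)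
    (auto simp: model_space_def taylor_coeff_model_U[OF assms(1)] assms(2) coeff_eq_iff)

lemma conv_scalar_coeff:
  assumes "\<And>n. \<phi> n = (\<lambda>x\<in>coker T. c n *\<^sub>C x)"
  shows "conv \<phi> (coeff f) n = (\<Sum>k\<le>n. c k *\<^sub>C coeff f (n - k))"
  by (simp add: conv_def assms)

text \<open>Full domain supplies, for each \<open>f\<close>, a vector whose coefficients are the
  convolution; the operator sends \<open>f\<close> to it.\<close>

lemma convolution_if_scalar_multiplier:
  assumes "\<exists>x::'a. x \<noteq> 0" "\<phi> \<in> scalar_multipliers T"
  obtains c where "\<And>f n. coeff ((model_U_adj T \<circ> mult_op T \<phi> \<circ> model_U T) f) n =
    (\<Sum>k\<le>n. c k *\<^sub>C coeff f (n - k))"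
proof -
  have "\<forall>n. \<exists>c. \<phi> n = (\<lambda>x\<in>coker T. c *\<^sub>C x)"
    using assms(2) by (simp add: scalar_multipliers_def)
  then obtain c where c: "\<And>n. \<phi> n = (\<lambda>x\<in>coker T. c n *\<^sub>C x)"
    by metis
  have "coeff ((model_U_adj T \<circ> mult_op T \<phi> \<circ> model_U T) f) = conv \<phi> (coeff f)" for f
  proof -
    have "model_U T f \<in> mult_dom T \<phi>"
      using assms(2) by (auto simp: scalar_multipliers_def gen_multiplier_def model_space_def)
    then obtain h where h: "conv \<phi> (coeff f) = coeff h"
      by (auto simp: mult_dom_def model_space_def taylor_coeff_model_U[OF assms(1)])
    then show ?thesis
      by (simp add: mult_op_model_U[OF assms(1) h] model_U_adj_model_U[OF assms(1)])
  qed
  then show ?thesis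
    using that[of c] conv_scalar_coeff[OF c] by simp
qed

text \<open>The domain is full because \<open>A f\<close> itself witnesses membership of
  \<open>model_U T f\<close>.\<close>

lemma scalar_multiplier_if_convolution:
  assumes "\<exists>x::'a. x \<noteq> 0" "\<And>f n. coeff (A f) n = (\<Sum>k\<le>n. c k *\<^sub>C coeff f (n - k))"
  obtains \<phi> where "\<phi> \<in> scalar_multipliers T" "model_U_adj T \<circ> mult_op T \<phi> \<circ> model_U T = A"
proof -
  \<comment> \<open>The restriction to \<open>coker T\<close> provides the extensionality demanded
    by \<open>bounded_ops\<close>.\<close>
  define \<phi> where "\<phi> n = (\<lambda>x\<in>coker T. c n *\<^sub>C x)" for n
  have conv: "conv \<phi> (coeff f) = coeff (A f)" for f
    using conv_scalar_coeff[of \<phi> c, OF \<phi>_def] assms(2) by (simp add: fun_eq_iff)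
  have "\<phi> n \<in> bounded_ops (coker T)" for n
    using complex_vector.subspace_add[OF subspace_coker] complex_vector.subspace_scale[OF subspace_coker]
    by (auto simp: bounded_ops_def \<phi>_def scaleC_add_right scaleC_scaleC mult.commute[of "c n"]
        norm_scaleC intro!: exI[of _ "cmod (c n)"])
  moreover have "mult_dom T \<phi> = model_space T"
    using conv by (auto simp: mult_dom_def model_space_def taylor_coeff_model_U[OF assms(1)])
  ultimately have "\<phi> \<in> scalar_multipliers T"
    by (auto simp: scalar_multipliers_def gen_multiplier_def \<phi>_def)
  moreover have "model_U_adj T \<circ> mult_op T \<phi> \<circ> model_U T = A"
    by (simp add: fun_eq_iff mult_op_model_U[OF assms(1) conv] model_U_adj_model_U[OF assms(1)])
  ultimately show ?thesis
    using that by blast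
qed

end

theorem theorem29:
  fixes T :: "'a::chilbert_space \<Rightarrow> 'a"
  assumes "\<exists>x::'a. x \<noteq> 0"
    and "T \<in> BH"
    and "left_invertible T"
    and "analytic T"
    and "{model_U_adj T \<circ> mult_op T \<phi> \<circ> model_U T | \<phi>. \<phi> \<in> scalar_multipliers T} = wot_algebra T"
  shows "reflexive T"
proof -
  interpret left_invertible_analytic_operator T
    using assms(2-4) by unfold_locales
  have "A \<in> wot_algebra T" if A: "A \<in> Alg (Lat (wot_algebra T))" for A
  proof -
    have "A \<in> BH"
      using A by (simp add: Alg_def)
    moreover have "eval_cinner e z (A f) = 0"
      if e: "e \<in> coker T" and z: "cmod z < rho" and f: "eval_cinner e z f = 0" for e z f
    proof -
      \<comment> \<open>By hypothesis every \<open>B\<close> in the algebra comes from a scalar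
        multiplier, hence acts as a scalar convolution.\<close>
      have "B ` {f. eval_cinner e z f = 0} \<subseteq> {f. eval_cinner e z f = 0}"
        if B: "B \<in> wot_algebra T" for B
      proof -
        obtain \<phi> where "\<phi> \<in> scalar_multipliers T"
          and "B = model_U_adj T \<circ> mult_op T \<phi> \<circ> model_U T"
          using B assms(5) by blast
        then obtain c where "\<And>f n. coeff (B f) n = (\<Sum>k\<le>n. c k *\<^sub>C coeff f (n - k))"
          using convolution_if_scalar_multiplier[OF assms(1)] by metis
        then show ?thesis
          using eval_cinner_convolution[OF z e] by blast
      qed
      then have "{f. eval_cinner e z f = 0} \<in> Lat (wot_algebra T)"
        unfolding Lat_def using eval_kernel[OF z] by blast
      then have "A ` {f. eval_cinner e z f = 0} \<subseteq> {f. eval_cinner e z f = 0}"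
        using A by (simp add: Alg_def)
      then show ?thesis
        using f by (simp add: image_subset_iff)
    qed
    ultimately obtain c where "\<And>f n. coeff (A f) n = (\<Sum>k\<le>n. c k *\<^sub>C coeff f (n - k))"
      using convolution_if_preserves_kernels[of A] by blast
    \<comment> \<open>Now the hypothesis is read in the other direction: a scalar convolution comes
      from a scalar multiplier and so belongs to the algebra.\<close>
    then obtain \<phi> where "\<phi> \<in> scalar_multipliers T" "model_U_adj T \<circ> mult_op T \<phi> \<circ> model_U T = A"
      using scalar_multiplier_if_convolution[OF assms(1), of A c] by blast
    then show ?thesis
      using assms(5) by blast
  qed
  then show ?thesis
    using subset_Alg_Lat[OF wot_algebra_subset_BH[OF assms(2)]] 
    unfolding reflexive_def by blast
qed

end
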